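(* Let $(G,\varepsilon)$ be an edge-weighted multigraph on $n$ vertices with no isolated vertices. Let $R\subseteq E$ and let $S\subseteq V$ consist of all isolated vertices of $G-R$, with $|S|=k$. Let $\lambda_1\le\dots\le\lambda_n$ and $\mu_1\le\dots\le\mu_{n-k}$ denote the normalised Laplacian eigenvalues (with multiplicity) of $(G,\varepsilon)$ and $(G-R-S,\varepsilon)$, respectively. Suppose $G[R]$ has $s$ vertices and $c$ connected components, $b$ of which are bipartite. Then $$\lambda_{i-s+c+k}\le\mu_i\le\lambda_{i+s-b}$$ for all $1\le i\le n-k$, where each inequality is asserted only when the eigenvalue $\lambda_j$ appearing in it is defined, i.e. $1\le j\le n$.
   Context: A graph is a finite multigraph with vertex set $V$ and edge set $E$ (loops and multiple edges allowed). An edge-weighted multigraph $(G,\varepsilon)$ is a graph with edge weights $\varepsilon:E\to\mathbb R_{>0}$. For $u,v\in V$, $\varepsilon(u,v)$ is the total edge weight between $u$ and $v$, with loops counted twice, and the degree is $d_{(G,\varepsilon)}(u)=\sum_{v\in V}\varepsilon(u,v)$; a vertex is isolated if its degree is zero. Let $A_{(G,\varepsilon)}=(\varepsilon(u,v))_{u,v}$, let $D_{(G,\varepsilon)}$ be the diagonal matrix of degrees, and $L_{(G,\varepsilon)}=D_{(G,\varepsilon)}-A_{(G,\varepsilon)}$. For a graph with no isolated vertices the normalised Laplacian is $D_{(G,\varepsilon)}^{-1}L_{(G,\varepsilon)}$; it is similar to the symmetric matrix $D_{(G,\varepsilon)}^{-1/2}L_{(G,\varepsilon)}D_{(G,\varepsilon)}^{-1/2}$,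 so it has real eigenvalues. $G-R$ is $G$ with the edges in $R$ removed (all vertices kept); $G-R-S$ is then obtained by removing the vertices in $S$. $G[R]$ is the subgraph consisting of the edges in $R$ and all vertices incident to them. Edge weights on subgraphs are inherited by restriction, and degrees for the normalised Laplacian of $(G-R-S,\varepsilon)$ are computed in $G-R-S$. *)

theory Defs
  imports
    "HOL-Library.Uprod"
    "Jordan_Normal_Form.Char_Poly"
    Complex_Main
begin

section \<open>Edge-weighted multigraphs\<close>

text \<open>
  Edges are abstract objects, so parallel edges are distinct edges with the same ends.
  The ends of an edge form an unordered pair; \<open>Upair v v\<close> is a loop at \<open>v\<close>.
\<close>

record ('v, 'e) wgraph =
  verts :: "'v set"
  edges :: "'e set"
  ends :: "'e \<Rightarrow> 'v uprod"
  weight :: "'e \<Rightarrow> real"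

locale edge_weighted_multigraph =
  fixes G :: "('v, 'e) wgraph"
  assumes finite_verts: "finite (verts G)"
    and finite_edges: "finite (edges G)"
    and ends_in_verts: "\<And>e. e \<in> edges G \<Longrightarrow> set_uprod (ends G e) \<subseteq> verts G"
    and weight_pos: "\<And>e. e \<in> edges G \<Longrightarrow> weight G e > 0"

definition total_weight :: "('v, 'e) wgraph \<Rightarrow> 'v \<Rightarrow> 'v \<Rightarrow> real" where
  "total_weight G u v =
    (if u = v then 2 else 1) * (\<Sum>e | e \<in> edges G \<and> ends G e = Upair u v. weight G e)"

definition degree_of :: "('v, 'e) wgraph \<Rightarrow> 'v \<Rightarrow> real" where
  "degree_of G u = (\<Sum>v\<in>verts G. total_weight G u v)"

definition isolated_verts :: "('v, 'e) wgraph \<Rightarrow> 'v set" where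
  "isolated_verts G = {v \<in> verts G. degree_of G v = 0}"

subsection \<open>Subgraphs\<close>

definition del_edges :: "('v, 'e) wgraph \<Rightarrow> 'e set \<Rightarrow> ('v, 'e) wgraph" where
  "del_edges G R = G\<lparr>edges := edges G - R\<rparr>"

definition del_verts :: "('v, 'e) wgraph \<Rightarrow> 'v set \<Rightarrow> ('v, 'e) wgraph" where
  "del_verts G S =
    G\<lparr>verts := verts G - S, edges := {e \<in> edges G. set_uprod (ends G e) \<inter> S = {}}\<rparr>"

definition edge_subgraph :: "('v, 'e) wgraph \<Rightarrow> 'e set \<Rightarrow> ('v, 'e) wgraph" where
  "edge_subgraph G R = G\<lparr>verts := (\<Union>e\<in>R. set_uprod (ends G e)), edges := R\<rparr>"

definition induced_subgraph :: "('v, 'e) wgraph \<Rightarrow> 'v set \<Rightarrow> ('v, 'e) wgraph" where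
  "induced_subgraph G C = G\<lparr>verts := C, edges := {e \<in> edges G. set_uprod (ends G e) \<subseteq> C}\<rparr>"

subsection \<open>Connected components and bipartiteness\<close>

definition adjacency :: "('v, 'e) wgraph \<Rightarrow> ('v \<times> 'v) set" where
  "adjacency G = {(u, v). \<exists>e\<in>edges G. ends G e = Upair u v}"

text \<open>
  A component is represented by its vertex set, an equivalence class of the relation
  ``joined by a walk''; the component as a graph is the subgraph induced on that set.
\<close>

definition components :: "('v, 'e) wgraph \<Rightarrow> 'v set set" where
  "components G = verts G // (adjacency G)\<^sup>*"

definition bipartite :: "('v, 'e) wgraph \<Rightarrow> bool" where
  "bipartite G \<longleftrightarrow> (\<exists>X Y. X \<union> Y = verts G \<and> X \<inter> Y = {} \<and>
    (\<forall>e\<in>edges G. \<exists>x\<in>X. \<exists>y\<in>Y. ends G e = Upair x y))"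

definition bipartite_components :: "('v, 'e) wgraph \<Rightarrow> 'v set set" where
  "bipartite_components G = {C \<in> components G. bipartite (induced_subgraph G C)}"

section \<open>The normalised Laplacian and its eigenvalues\<close>

text \<open>
  Rows and columns of a matrix are indexed by \<open>0, \<dots>, n - 1\<close>, so the vertices have to be
  enumerated. Another enumeration conjugates the matrices below by a permutation matrix and
  hence gives the same eigenvalues.
\<close>

definition vertex_enum :: "('v, 'e) wgraph \<Rightarrow> 'v list" where
  "vertex_enum G = (SOME vs. set vs = verts G \<and> distinct vs)"

definition adjacency_mat :: "('v, 'e) wgraph \<Rightarrow> real mat" where
  "adjacency_mat G = mat (card (verts G)) (card (verts G))
    (\<lambda>(i, j). total_weight G (vertex_enum G ! i) (vertex_enum G ! j))"

definition degree_mat :: "('v, 'e) wgraph \<Rightarrow> real mat" where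
  "degree_mat G = mat_diag (card (verts G)) (\<lambda>i. degree_of G (vertex_enum G ! i))"

definition laplacian :: "('v, 'e) wgraph \<Rightarrow> real mat" where
  "laplacian G = degree_mat G - adjacency_mat G"

text \<open>
  Without isolated vertices, the first factor is the inverse of \<^term>\<open>degree_mat G\<close>.
\<close>

definition normalised_laplacian :: "('v, 'e) wgraph \<Rightarrow> real mat" where
  "normalised_laplacian G =
    mat_diag (card (verts G)) (\<lambda>i. inverse (degree_of G (vertex_enum G ! i))) * laplacian G"

text \<open>
  The real roots of the characteristic polynomial in increasing order, repeated according to
  multiplicity. Without isolated vertices the normalised Laplacian is similar to a real symmetric
  matrix, so its characteristic polynomial splits over the reals and the list has as many entries
  as there are vertices.
\<close>

definition nl_eigenvalues :: "('v, 'e) wgraph \<Rightarrow> real list" where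
  "nl_eigenvalues G = sorted_list_of_multiset (proots (char_poly (normalised_laplacian G)))"

text \<open>
  Eigenvalues are numbered from 1. The index is an integer because index expressions may be
  non-positive; the value is meaningful only for indices from 1 to the number of vertices.
\<close>

definition nl_eigenvalue :: "('v, 'e) wgraph \<Rightarrow> int \<Rightarrow> real" where
  "nl_eigenvalue G j = nl_eigenvalues G ! nat (j - 1)"

end

theory Submission
  imports Defs "Jordan_Normal_Form.Spectral_Radius"
begin

text \<open>
  Write \<open>H = G - R - S\<close>. The eigenvalues of \<open>D\<^sup>-\<^sup>1 L\<close> are the eigenvalues of the quadratic form \<open>x\<^sup>T L x\<close>,
  a weighted sum of the squares \<open>(x\<^sub>u - x\<^sub>v)\<^sup>2\<close> over the edges \<open>u v\<close>, relative to the degree form \<open>x\<^sup>T D x\<close>,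
  the corresponding sum of \<open>x\<^sub>u\<^sup>2 + x\<^sub>v\<^sup>2\<close>. Deleting edges can only decrease the degree form, and it does
  not change the Laplacian form at vectors that are constant on the components of \<open>G[R]\<close>. These vectors
  are the solutions of \<open>s - c\<close> linear equations. Require in addition that the first \<open>j - 1\<close> eigenvector
  coordinates with respect to \<open>G\<close> and the last \<open>n - k - i\<close> with respect to \<open>H\<close> vanish. If
  \<open>j = i - s + c + k\<close>, there are at most \<open>n - 1\<close> equations on a vector in \<open>n\<close> coordinates, hence a nonzero
  solution \<open>x\<close>, and it satisfies
  \<open>\<lambda>\<^sub>j x\<^sup>T D\<^sub>G x \<le> x\<^sup>T L\<^sub>G x = x\<^sup>T L\<^sub>H x \<le> \<mu>\<^sub>i x\<^sup>T D\<^sub>H x \<le> \<mu>\<^sub>i x\<^sup>T D\<^sub>G x\<close>, because \<open>\<mu>\<^sub>i \<ge> 0\<close>. Since \<open>x\<^sup>T D\<^sub>G x > 0\<close>,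
  this is the lower bound (\<open>eigenvalue_lower\<close>).

  The upper bound (\<open>eigenvalue_upper\<close>) is the same argument for the signless Laplacian \<open>2 D - L\<close>, with
  the squares \<open>(x\<^sub>u + x\<^sub>v)\<^sup>2\<close> and the eigenvalues \<open>2 - \<lambda>\<close> and \<open>2 - \<mu>\<close>. Its form is unchanged at vectors that
  take opposite values at the ends of each edge in \<open>R\<close>. Such a vector has one free value on each bipartite
  component of \<open>G[R]\<close> and vanishes on the other components; this amounts to \<open>s - b\<close> equations.

  The eigenvector coordinates come from the spectral theorem for real symmetric matrices
  (\<open>real_spectral_theorem\<close>) applied to \<open>D\<^sup>-\<^sup>1\<^sup>/\<^sup>2 L D\<^sup>-\<^sup>1\<^sup>/\<^sup>2\<close>. The equations are counted
  by \<open>homogeneous_system_nontrivial_solution\<close> and \<open>component_constraints\<close>.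
\<close>

section \<open>The spectral theorem for real symmetric matrices\<close>

text \<open>
  The real and imaginary parts \<open>x\<close>, \<open>y\<close> of a complex eigenvector span a real invariant subspace.
  Comparing \<open>y \<bullet> A x\<close> with \<open>x \<bullet> A y\<close> shows that symmetry forces the imaginary part of the eigenvalue
  to vanish, and then \<open>x\<close> or \<open>y\<close> is itself a real eigenvector.
\<close>
lemma real_symmetric_eigenvector:
  fixes A :: "real mat"
  assumes A: "A \<in> carrier_mat n n" and sym: "transpose_mat A = A" and n: "n > 0"
  obtains e v where "v \<in> carrier_vec n" "v \<bullet> v = 1" "A *\<^sub>v v = e \<cdot>\<^sub>v v"
proof -
  let ?C = "map_mat complex_of_real A"
  have C: "?C \<in> carrier_mat n n" using A by simp
  from spectrum_non_empty[OF C n] obtain k where "eigenvalue ?C k"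
    unfolding spectrum_def by auto
  then obtain z where z: "z \<in> carrier_vec n" "z \<noteq> 0\<^sub>v n" "?C *\<^sub>v z = k \<cdot>\<^sub>v z"
    unfolding eigenvalue_def eigenvector_def using C by auto
  define x where "x = map_vec Re z"
  define y where "y = map_vec Im z"
  have x: "x \<in> carrier_vec n" and y: "y \<in> carrier_vec n"
    using z unfolding x_def y_def by auto
  have row: "(\<Sum>j<n. complex_of_real (A $$ (i,j)) * z $ j) = k * z $ i" if "i < n" for i
  proof -
    have "(?C *\<^sub>v z) $ i = (k \<cdot>\<^sub>v z) $ i" using z by simp
    then show ?thesis using that A z(1)
      by (simp add: scalar_prod_def lessThan_atLeast0)
  qed
  have Ax: "A *\<^sub>v x = Re k \<cdot>\<^sub>v x - Im k \<cdot>\<^sub>v y"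
  proof (rule eq_vecI)
    fix i assume "i < dim_vec (Re k \<cdot>\<^sub>v x - Im k \<cdot>\<^sub>v y)"
    then have i: "i < n" using y by simp
    show "(A *\<^sub>v x) $ i = (Re k \<cdot>\<^sub>v x - Im k \<cdot>\<^sub>v y) $ i"
      using arg_cong[OF row[OF i], of Re] i A z(1) unfolding x_def y_def
      by (simp add: scalar_prod_def lessThan_atLeast0)
  qed (use A y in auto)
  have Ay: "A *\<^sub>v y = Im k \<cdot>\<^sub>v x + Re k \<cdot>\<^sub>v y"
  proof (rule eq_vecI)
    fix i assume "i < dim_vec (Im k \<cdot>\<^sub>v x + Re k \<cdot>\<^sub>v y)"
    then have i: "i < n" using y by simp
    show "(A *\<^sub>v y) $ i = (Im k \<cdot>\<^sub>v x + Re k \<cdot>\<^sub>v y) $ i"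
      using arg_cong[OF row[OF i], of Im] i A z(1) unfolding x_def y_def
      by (simp add: scalar_prod_def lessThan_atLeast0 algebra_simps)
  qed (use A y in auto)
  have "y \<bullet> (A *\<^sub>v x) = (A *\<^sub>v y) \<bullet> x"
    using transpose_vec_mult_scalar[OF A x y] sym by simp
  then have imk: "Im k * (x \<bullet> x + y \<bullet> y) = 0"
    unfolding Ax Ay using x y
    by (simp add: scalar_prod_minus_distrib[of _ n] add_scalar_prod_distrib[of _ n]
        comm_scalar_prod[of y n x] algebra_simps)
  have nonneg: "v \<bullet> v \<ge> 0" for v :: "real vec"
    unfolding scalar_prod_def by (rule sum_nonneg) simp
  have pos: "v \<bullet> v > 0" if v: "v \<in> carrier_vec n" "v \<noteq> 0\<^sub>v n" for v :: "real vec"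
  proof -
    have "\<exists>i<n. v $ i \<noteq> 0"
    proof (rule ccontr)
      assume "\<not> ?thesis"
      then have "v = 0\<^sub>v n" using v(1) by (intro eq_vecI) auto
      with v(2) show False by simp
    qed
    then obtain i where i: "i < n" "v $ i \<noteq> 0" by blast
    have "0 < v $ i * v $ i" using not_real_square_gt_zero[of "v $ i"] i(2) by blast
    also have "\<dots> \<le> (\<Sum>j\<in>{0..<n}. v $ j * v $ j)"
      using i(1) by (intro member_le_sum) simp_all
    finally show ?thesis using v(1) by (simp add: scalar_prod_def)
  qed
  have nz: "x \<noteq> 0\<^sub>v n \<or> y \<noteq> 0\<^sub>v n"
  proof (rule ccontr)
    assume a: "\<not> ?thesis"
    have "z = 0\<^sub>v n"
    proof (rule eq_vecI)
      fix i assume "i < dim_vec (0\<^sub>v n :: complex vec)"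
      then have i: "i < n" by simp
      from a have "x $ i = 0" "y $ i = 0" using i by auto
      then show "z $ i = 0\<^sub>v n $ i" using i z unfolding x_def y_def by (auto intro: complex_eqI)
    qed (use z in auto)
    with z show False by simp
  qed
  have "x \<bullet> x + y \<bullet> y > 0"
    using nz pos[OF x] pos[OF y] nonneg[of x] nonneg[of y] by linarith
  with imk have "Im k = 0" by simp
  then have "A *\<^sub>v x = Re k \<cdot>\<^sub>v x" "A *\<^sub>v y = Re k \<cdot>\<^sub>v y"
    using Ax Ay x y by (auto intro!: eq_vecI)
  with nz x y obtain w where w: "w \<in> carrier_vec n" "w \<noteq> 0\<^sub>v n" "A *\<^sub>v w = Re k \<cdot>\<^sub>v w" by auto
  define v where "v = (1 / sqrt (w \<bullet> w)) \<cdot>\<^sub>v w"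
  have "v \<in> carrier_vec n" using w v_def by simp
  moreover have "v \<bullet> v = 1" unfolding v_def using w pos[OF w(1,2)] by (simp add: field_simps)
  moreover have "A *\<^sub>v v = Re k \<cdot>\<^sub>v v" unfolding v_def using w A
    by (simp add: mult_mat_vec[OF A w(1)] smult_smult_assoc mult.commute)
  ultimately show ?thesis by (rule that)
qed

text \<open>
  The reflection \<open>1 - 2 u u\<^sup>T / (u \<bullet> u)\<close> in the hyperplane orthogonal to \<open>u = v - e\<^sub>0\<close> exchanges the
  unit vectors \<open>v\<close> and \<open>e\<^sub>0\<close>. It extends \<open>v\<close> to an orthonormal basis by an explicit formula.
\<close>
lemma householder_reflection:
  fixes v :: "real vec"
  assumes v: "v \<in> carrier_vec n" "v \<bullet> v = 1" and n: "n > 0"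
  obtains W where "W \<in> carrier_mat n n" "transpose_mat W = W" "W * W = 1\<^sub>m n" "col W 0 = v"
proof -
  define u where "u i = v $ i - (if i = 0 then 1 else 0)" for i
  define q where "q = (\<Sum>i<n. u i * u i)"
  \<comment> \<open>If \<open>v\<close> is the first unit vector, then \<open>q = 0\<close>, so \<open>c = 0\<close> and \<open>W\<close> is the identity.\<close>
  define c where "c = 2 / q"
  define W where "W = mat n n (\<lambda>(i,j). (if i = j then 1 else 0) - c * u i * u j)"
  have W: "W \<in> carrier_mat n n" by (simp add: W_def)
  have sym: "transpose_mat W = W" unfolding W_def by (intro eq_matI) (auto)
  have vv: "(\<Sum>i<n. v $ i * v $ i) = 1" using v by (simp add: scalar_prod_def lessThan_atLeast0)
  have "q = (\<Sum>i<n. v $ i * v $ i - (if i = 0 then 2 * v $ 0 - 1 else 0))"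
    unfolding q_def u_def by (intro sum.cong) (auto simp: algebra_simps)
  then have q: "q = 2 - 2 * v $ 0"
    using vv n by (simp add: sum_subtractf)
  have cq: "c * c * q = 2 * c" unfolding c_def by simp
  have WW: "W * W = 1\<^sub>m n"
  proof (rule eq_matI)
    fix i j assume "i < dim_row (1\<^sub>m n :: real mat)" "j < dim_col (1\<^sub>m n :: real mat)"
    then have ij: "i < n" "j < n" by auto
    have "(W * W) $$ (i,j) = (\<Sum>l<n. ((if i = l then 1 else 0) - c * u i * u l) * ((if l = j then 1 else 0) - c * u l * u j))"
      using ij unfolding W_def by (simp add: scalar_prod_def lessThan_atLeast0)
    also have "\<dots> = (\<Sum>l<n. (if i = l then if l = j then 1 else 0 else 0) - (if i = l then c * u l * u j else 0)
       - (if l = j then c * u i * u l else 0) + c * c * u i * u j * (u l * u l))"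
      by (intro sum.cong) (auto simp: algebra_simps)
    also have "\<dots> = (if i = j then 1 else 0) - 2 * c * u i * u j + c * c * q * u i * u j"
      using ij unfolding q_def by (simp add: sum.distrib sum_subtractf sum_distrib_left sum_distrib_right algebra_simps)
    also have "\<dots> = 1\<^sub>m n $$ (i,j)" unfolding cq using ij by simp
    finally show "(W * W) $$ (i,j) = 1\<^sub>m n $$ (i,j)" .
  qed (use W in auto)
  have col: "col W 0 = v"
  proof (rule eq_vecI)
    fix i assume "i < dim_vec v"
    then have i: "i < n" using v by simp
    have "c * u 0 * u i = - u i"
    proof (cases "q = 0")
      case True
      then have "\<forall>i\<in>{..<n}. u i * u i = 0" unfolding q_def
        by (subst (asm) sum_nonneg_eq_0_iff) auto
      then show ?thesis using i by simp
    next
      case False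
      have "c * u 0 = -1" using False unfolding c_def u_def q by (simp add: field_simps)
      then show ?thesis by simp
    qed
    then show "col W 0 $ i = v $ i" using i n unfolding W_def u_def
      by (simp add: algebra_simps)
  qed (use v W in auto)
  show ?thesis using that[OF W sym WW col] .
qed

text \<open>
  Deflation: conjugating \<open>A\<close> by a Householder reflection that carries the first unit vector to an
  eigenvector clears the first column, hence by symmetry also the first row, outside the diagonal;
  the induction hypothesis diagonalises the remaining block.
\<close>
theorem real_spectral_theorem:
  fixes A :: "real mat"
  assumes "A \<in> carrier_mat n n" and "transpose_mat A = A"
  obtains P es where "P \<in> carrier_mat n n" "length es = n" "transpose_mat P * P = 1\<^sub>m n"
    "A = P * mat_diag n (\<lambda>i. es ! i) * transpose_mat P"
proof -
  have "\<exists>P es. P \<in> carrier_mat n n \<and> length es = n \<and> transpose_mat P * P = 1\<^sub>m n \<and>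
    A = P * mat_diag n (\<lambda>i. es ! i) * transpose_mat P"
    using assms
  proof (induction n arbitrary: A)
    case 0
    then show ?case by (intro exI[of _ "1\<^sub>m 0"] exI[of _ "[]"]) (auto intro!: eq_matI)
  next
    case (Suc m)
    let ?n = "Suc m"
    note A = Suc.prems(1) and symA = Suc.prems(2)
    obtain e v where ev: "v \<in> carrier_vec ?n" "v \<bullet> v = 1" "A *\<^sub>v v = e \<cdot>\<^sub>v v"
      by (rule real_symmetric_eigenvector[OF A symA zero_less_Suc])
    obtain W where W: "W \<in> carrier_mat ?n ?n" "transpose_mat W = W" "W * W = 1\<^sub>m ?n" "col W 0 = v"
      by (rule householder_reflection[OF ev(1,2) zero_less_Suc])
    define B where "B = W * A * W"
    have B: "B \<in> carrier_mat ?n ?n" unfolding B_def using A W by auto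
    have symB: "transpose_mat B = B" unfolding B_def
      using A W symA by (simp add: transpose_mult[of _ ?n ?n _ ?n] assoc_mult_mat[of _ ?n ?n _ ?n _ ?n])
    have AWBW: "A = W * B * W"
    proof -
      have "W * B * W = (W * W) * A * (W * W)" unfolding B_def
        using A W(1) by (simp add: assoc_mult_mat[of _ ?n ?n _ ?n _ ?n])
      then show ?thesis using A W(3) by simp
    qed
    have colB: "col B 0 = e \<cdot>\<^sub>v unit_vec ?n 0"
    proof -
      have "col B 0 = W *\<^sub>v (A *\<^sub>v col W 0)" unfolding B_def
        by (subst assoc_mult_mat[OF W(1) A W(1)], subst col_mult2[OF W(1) mult_carrier_mat[OF A W(1)]], simp,
            subst col_mult2[OF A W(1)], simp_all)
      also have "\<dots> = e \<cdot>\<^sub>v (W *\<^sub>v col W 0)" using W(1) ev by (simp add: W(4) mult_mat_vec[OF W(1) ev(1)])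
      also have "W *\<^sub>v col W 0 = col (W * W) 0" by (rule col_mult2[OF W(1) W(1), symmetric]) simp
      also have "\<dots> = unit_vec ?n 0" unfolding W(3) by (simp)
      finally show ?thesis .
    qed
    have B0: "B $$ (i, 0) = (if i = 0 then e else 0)" if "i < ?n" for i
      using arg_cong[OF colB, of "\<lambda>w. w $ i"] that B by simp
    have Bsym: "B $$ (i,j) = B $$ (j,i)" if "i < ?n" "j < ?n" for i j
      using arg_cong[OF symB, of "\<lambda>M. M $$ (i,j)"] that B by simp
    define B' where "B' = mat m m (\<lambda>(i,j). B $$ (Suc i, Suc j))"
    have "B' \<in> carrier_mat m m" "transpose_mat B' = B'"
      unfolding B'_def using Bsym by (auto intro!: eq_matI)
    from Suc.IH[OF this] obtain P' es where P': "P' \<in> carrier_mat m m" "length es = m"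
      "transpose_mat P' * P' = 1\<^sub>m m" "B' = P' * mat_diag m (\<lambda>i. es ! i) * transpose_mat P'" by blast
    define E where "E = mat 1 1 (\<lambda>_. e)"
    have E: "E \<in> carrier_mat 1 1" unfolding E_def by simp
    define Q where "Q = four_block_mat (1\<^sub>m 1) (0\<^sub>m 1 m) (0\<^sub>m m 1) P'"
    have Q: "Q \<in> carrier_mat ?n ?n" unfolding Q_def using P'
      by (metis four_block_carrier_mat one_carrier_mat plus_1_eq_Suc)
    have QT: "transpose_mat Q = four_block_mat (1\<^sub>m 1) (0\<^sub>m 1 m) (0\<^sub>m m 1) (transpose_mat P')"
      unfolding Q_def using P' by (subst transpose_four_block_mat[of _ 1 1 _ m _ m]) auto
    have blk: "four_block_mat X (0\<^sub>m 1 m) (0\<^sub>m m 1) M * four_block_mat Y (0\<^sub>m 1 m) (0\<^sub>m m 1) N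
      = four_block_mat (X * Y) (0\<^sub>m 1 m) (0\<^sub>m m 1) (M * N)"
      if c: "X \<in> carrier_mat 1 1" "Y \<in> carrier_mat 1 1" "M \<in> carrier_mat m m" "N \<in> carrier_mat m m"
      for X Y M N :: "real mat"
    proof -
      note zz = zero_carrier_mat[of 1 m] zero_carrier_mat[of m 1]
      show ?thesis
        unfolding mult_four_block_mat[OF c(1) zz c(3) c(2) zz c(4)]
        using c by (intro cong_four_block_mat) simp_all
    qed
    have QQ: "transpose_mat Q * Q = 1\<^sub>m ?n"
      unfolding QT unfolding Q_def using P' by (subst blk) simp_all
    have diag: "mat_diag ?n (\<lambda>i. (e # es) ! i) = four_block_mat E (0\<^sub>m 1 m) (0\<^sub>m m 1) (mat_diag m (\<lambda>i. es ! i))"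
      unfolding mat_diag_def E_def by (intro eq_matI) (auto simp: nth_Cons')
    have "Q * mat_diag ?n (\<lambda>i. (e # es) ! i) * transpose_mat Q = four_block_mat E (0\<^sub>m 1 m) (0\<^sub>m m 1) B'"
    proof -
      let ?d = "mat_diag m (\<lambda>i. es ! i)"
      have c: "1\<^sub>m 1 * E \<in> carrier_mat 1 1" "P' * ?d \<in> carrier_mat m m" "transpose_mat P' \<in> carrier_mat m m"
        using E P'(1) by (auto intro: mult_carrier_mat[of _ m m])
      show ?thesis
        unfolding diag QT P'(4) unfolding Q_def blk[OF one_carrier_mat E P'(1) mat_diag_dim]
          blk[OF c(1) one_carrier_mat c(2,3)]
        using E by (simp only: left_mult_one_mat[OF E] right_mult_one_mat[OF E])
    qed
    also have "\<dots> = B" unfolding E_def B'_def using B B0 Bsym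
      by (intro eq_matI) auto
    finally have Beq: "B = Q * mat_diag ?n (\<lambda>i. (e # es) ! i) * transpose_mat Q" by simp
    let ?P = "W * Q" and ?D = "mat_diag ?n (\<lambda>i. (e # es) ! i)"
    have P: "?P \<in> carrier_mat ?n ?n" using W Q by simp
    have PT: "transpose_mat ?P = transpose_mat Q * W" using W Q by (simp add: transpose_mult[of _ ?n ?n _ ?n])
    have "transpose_mat ?P * ?P = transpose_mat Q * ((W * W) * Q)" unfolding PT using W(1) Q
      by (simp add: assoc_mult_mat[of _ ?n ?n _ ?n _ ?n])
    then have PP: "transpose_mat ?P * ?P = 1\<^sub>m ?n" using W(3) Q QQ by simp
    have "A = ?P * ?D * transpose_mat ?P"
    proof -
      have D: "?D \<in> carrier_mat ?n ?n" by (rule mat_diag_dim)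
      have "W * (Q * ?D * T) * W = W * Q * ?D * (T * W)" if "T \<in> carrier_mat ?n ?n" for T
        using W(1) Q D that
        by (simp only: assoc_mult_mat[of _ ?n ?n _ ?n _ ?n] mult_carrier_mat[of _ ?n ?n _ ?n])
      then show ?thesis unfolding PT AWBW Beq using Q by simp
    qed
    with P PP P'(2) show ?case by (intro exI[of _ ?P] exI[of _ "e # es"]) auto
  qed
  with that show ?thesis by blast
qed

lemma quadratic_form_diagonalised:
  fixes P :: "real mat"
  assumes P: "P \<in> carrier_mat n n" and M: "M = P * mat_diag n g * transpose_mat P"
  shows "(\<Sum>i<n. \<Sum>j<n. M $$ (i,j) * y i * y j) = (\<Sum>a<n. g a * (\<Sum>i<n. P $$ (i,a) * y i)^2)"
proof -
  have Mij: "M $$ (i,j) = (\<Sum>a<n. P $$ (i,a) * g a * P $$ (j,a))" if "i < n" "j < n" for i j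
    unfolding M mat_diag_mult_right[OF P] using that P
    by (simp add: scalar_prod_def lessThan_atLeast0)
  have "(\<Sum>i<n. \<Sum>j<n. M $$ (i,j) * y i * y j)
    = (\<Sum>i<n. \<Sum>j<n. \<Sum>a<n. g a * ((P $$ (i,a) * y i) * (P $$ (j,a) * y j)))"
    by (intro sum.cong refl) (simp add: Mij sum_distrib_right sum_distrib_left algebra_simps)
  also have "\<dots> = (\<Sum>i<n. \<Sum>a<n. \<Sum>j<n. g a * ((P $$ (i,a) * y i) * (P $$ (j,a) * y j)))"
    by (rule sum.cong[OF refl], rule sum.swap)
  also have "\<dots> = (\<Sum>a<n. \<Sum>i<n. \<Sum>j<n. g a * ((P $$ (i,a) * y i) * (P $$ (j,a) * y j)))"
    by (rule sum.swap)
  also have "\<dots> = (\<Sum>a<n. g a * (\<Sum>i<n. P $$ (i,a) * y i)^2)"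
    by (simp only: power2_eq_square sum_product) (simp only: sum_distrib_left)
  finally show ?thesis .
qed

section \<open>The degree form and the Laplacian form\<close>

definition degree_form :: "('v, 'e) wgraph \<Rightarrow> ('v \<Rightarrow> real) \<Rightarrow> real" where
  "degree_form G x = (\<Sum>v\<in>verts G. degree_of G v * (x v)\<^sup>2)"

definition laplacian_form :: "('v, 'e) wgraph \<Rightarrow> ('v \<Rightarrow> real) \<Rightarrow> real" where
  "laplacian_form G x =
    degree_form G x - (\<Sum>u\<in>verts G. \<Sum>v\<in>verts G. total_weight G u v * x u * x v)"

context edge_weighted_multigraph
begin

text \<open>
  Orienting every edge arbitrarily turns the forms into sums over edges. The orientation \<open>p\<close>, \<open>q\<close>
  is a parameter because the forms of a graph and of its subgraph are compared edge by edge
  with respect to one and the same orientation.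
\<close>
lemma obtain_endpoints:
  obtains p q where "\<forall>e\<in>edges G. ends G e = Upair (p e) (q e)"
proof -
  have "\<exists>u v. ends G e = Upair u v" for e
    by (rule uprod_exhaust[of "ends G e"]) (intro exI)
  then obtain p q where "\<And>e. ends G e = Upair (p e) (q e)" by metis
  then show ?thesis by (intro that[of p q]) simp
qed

lemma endpoints_in_verts:
  assumes "\<forall>e\<in>edges G. ends G e = Upair (p e) (q e)" "e \<in> edges G"
  shows "p e \<in> verts G" "q e \<in> verts G"
  using ends_in_verts[OF assms(2)] assms by auto

text \<open>
  Both indicator products are 1 exactly when the edge is a loop at \<open>u = v\<close>; this accounts for the
  double weight of loops and makes the formula uniform.
\<close>
lemma total_weight_sum_edges:
  assumes pq: "\<forall>e\<in>edges G. ends G e = Upair (p e) (q e)"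
  shows "total_weight G u v = (\<Sum>e\<in>edges G. weight G e *
    (of_bool (p e = u) * of_bool (q e = v) + of_bool (q e = u) * of_bool (p e = v)))"
proof -
  have "total_weight G u v = (\<Sum>e\<in>edges G. (if u = v then 2 else 1) * (if ends G e = Upair u v then weight G e else 0))"
    unfolding total_weight_def using finite_edges
    by (simp add: sum_distrib_left sum.inter_filter)
  also have "\<dots> = (\<Sum>e\<in>edges G. weight G e *
    (of_bool (p e = u) * of_bool (q e = v) + of_bool (q e = u) * of_bool (p e = v)))"
    by (intro sum.cong refl) (auto simp: pq)
  finally show ?thesis .
qed

lemma sum_total_weight:
  assumes pq: "\<forall>e\<in>edges G. ends G e = Upair (p e) (q e)"
  shows "(\<Sum>u\<in>verts G. \<Sum>v\<in>verts G. total_weight G u v * h u v)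
    = (\<Sum>e\<in>edges G. weight G e * (h (p e) (q e) + h (q e) (p e)))"
proof -
  have pick: "(\<Sum>u\<in>verts G. \<Sum>v\<in>verts G. of_bool (a = u) * of_bool (b = v) * h u v) = h a b"
    if "a \<in> verts G" "b \<in> verts G" for a b
  proof -
    have "(\<Sum>v\<in>verts G. of_bool (a = u) * of_bool (b = v) * h u v) = (if a = u then h u b else 0)" for u
      using that finite_verts by (simp add: of_bool_def if_distrib[of "\<lambda>t. t * _"] cong: if_cong)
    then show ?thesis using that finite_verts by simp
  qed
  have "(\<Sum>u\<in>verts G. \<Sum>v\<in>verts G. total_weight G u v * h u v)
    = (\<Sum>u\<in>verts G. \<Sum>v\<in>verts G. \<Sum>e\<in>edges G. weight G e *
        (of_bool (p e = u) * of_bool (q e = v) * h u v + of_bool (q e = u) * of_bool (p e = v) * h u v))"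
    unfolding total_weight_sum_edges[OF pq]
    by (simp add: sum_distrib_right distrib_right mult.assoc)
  also have "\<dots> = (\<Sum>u\<in>verts G. \<Sum>e\<in>edges G. \<Sum>v\<in>verts G. weight G e *
        (of_bool (p e = u) * of_bool (q e = v) * h u v + of_bool (q e = u) * of_bool (p e = v) * h u v))"
    by (rule sum.cong[OF refl], rule sum.swap)
  also have "\<dots> = (\<Sum>e\<in>edges G. \<Sum>u\<in>verts G. \<Sum>v\<in>verts G. weight G e *
        (of_bool (p e = u) * of_bool (q e = v) * h u v + of_bool (q e = u) * of_bool (p e = v) * h u v))"
    by (rule sum.swap)
  also have "\<dots> = (\<Sum>e\<in>edges G. weight G e * (h (p e) (q e) + h (q e) (p e)))"
    by (intro sum.cong refl)
      (simp only: sum_distrib_left[symmetric] sum.distrib pick endpoints_in_verts[OF pq])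
  finally show ?thesis .
qed

lemma degree_form_edges:
  assumes pq: "\<forall>e\<in>edges G. ends G e = Upair (p e) (q e)"
  shows "degree_form G x = (\<Sum>e\<in>edges G. weight G e * ((x (p e))\<^sup>2 + (x (q e))\<^sup>2))"
  using sum_total_weight[OF pq, of "\<lambda>u v. (x u)\<^sup>2"]
  unfolding degree_form_def degree_of_def by (simp add: sum_distrib_right)

lemma laplacian_form_edges:
  assumes pq: "\<forall>e\<in>edges G. ends G e = Upair (p e) (q e)"
  shows "laplacian_form G x = (\<Sum>e\<in>edges G. weight G e * (x (p e) - x (q e))\<^sup>2)"
proof -
  have "(\<Sum>u\<in>verts G. \<Sum>v\<in>verts G. total_weight G u v * x u * x v)
    = (\<Sum>e\<in>edges G. weight G e * (2 * x (p e) * x (q e)))"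
    using sum_total_weight[OF pq, of "\<lambda>u v. x u * x v"] by (simp add: mult.assoc mult.commute[of "x (q _)"])
  then show ?thesis
    unfolding laplacian_form_def degree_form_edges[OF pq]
    by (simp only: sum_subtractf[symmetric]) (intro sum.cong refl, simp add: power2_diff algebra_simps)
qed

text \<open>
  This is the quadratic form of the signless Laplacian \<open>D + A = 2 D - L\<close>. It is to bipartite components
  what the Laplacian form is to connected components: it vanishes on vectors that change sign along
  each edge.
\<close>
lemma signless_form_edges:
  assumes pq: "\<forall>e\<in>edges G. ends G e = Upair (p e) (q e)"
  shows "2 * degree_form G x - laplacian_form G x = (\<Sum>e\<in>edges G. weight G e * (x (p e) + x (q e))\<^sup>2)"
  unfolding degree_form_edges[OF pq] laplacian_form_edges[OF pq]
  by (simp add: sum_distrib_left sum_subtractf[symmetric]) (intro sum.cong refl, simp add: power2_eq_square algebra_simps)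

lemma degree_of_edges:
  assumes pq: "\<forall>e\<in>edges G. ends G e = Upair (p e) (q e)"
    and v: "v \<in> verts G"
  shows "degree_of G v = (\<Sum>e\<in>edges G. weight G e * (of_bool (p e = v) + of_bool (q e = v)))"
proof -
  have "degree_of G v = degree_form G (\<lambda>u. of_bool (u = v))"
    unfolding degree_form_def using v finite_verts
    by (simp add: of_bool_def if_distrib[of "\<lambda>t. _ * t"] if_distrib[of "\<lambda>t. t\<^sup>2"] cong: if_cong)
  moreover have "(of_bool b :: real)\<^sup>2 = of_bool b" for b by (cases b) simp_all
  ultimately show ?thesis by (simp only: degree_form_edges[OF pq])
qed

lemma isolated_verts_no_edges:
  "isolated_verts G = {v \<in> verts G. \<forall>e\<in>edges G. v \<notin> set_uprod (ends G e)}"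
proof -
  obtain p q where pq: "\<forall>e\<in>edges G. ends G e = Upair (p e) (q e)"
    by (rule obtain_endpoints)
  have "degree_of G v = 0 \<longleftrightarrow> (\<forall>e\<in>edges G. v \<notin> set_uprod (ends G e))" if v: "v \<in> verts G" for v
    unfolding degree_of_edges[OF pq v]
  proof (subst sum_nonneg_eq_0_iff[OF finite_edges])
    show "0 \<le> weight G e * (of_bool (p e = v) + of_bool (q e = v))" if "e \<in> edges G" for e
      using weight_pos[OF that] by simp
    show "(\<forall>e\<in>edges G. weight G e * (of_bool (p e = v) + of_bool (q e = v)) = 0)
      \<longleftrightarrow> (\<forall>e\<in>edges G. v \<notin> set_uprod (ends G e))"
      by (intro ball_cong refl) (use weight_pos pq in \<open>force simp: of_bool_def\<close>)
  qed
  then show ?thesis unfolding isolated_verts_def by blast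
qed

lemma degree_of_nonneg: "v \<in> verts G \<Longrightarrow> degree_of G v \<ge> 0"
  unfolding degree_of_def total_weight_def
  using weight_pos[THEN less_imp_le] by (intro sum_nonneg mult_nonneg_nonneg) simp_all

lemma degree_of_pos: "isolated_verts G = {} \<Longrightarrow> v \<in> verts G \<Longrightarrow> degree_of G v > 0"
  using degree_of_nonneg[of v] unfolding isolated_verts_def by force

lemma degree_form_pos:
  assumes "isolated_verts G = {}" "\<exists>v\<in>verts G. x v \<noteq> 0"
  shows "degree_form G x > 0"
proof -
  obtain v where v: "v \<in> verts G" "x v \<noteq> 0" using assms(2) by blast
  have "0 < degree_of G v * (x v)\<^sup>2"
    using degree_of_pos[OF assms(1) v(1)] v(2) by simp
  then show ?thesis unfolding degree_form_def
    by (rule sum_pos2[OF finite_verts v(1)]) (simp add: degree_of_nonneg)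
qed

end

section \<open>Eigenvector coordinates\<close>

lemma total_weight_commute: "total_weight G u v = total_weight G v u"
proof -
  have U: "Upair u v = Upair v u" by simp
  show ?thesis unfolding total_weight_def by (subst U) auto
qed

text \<open>
  Coordinates in a \<open>D\<close>-orthonormal basis of eigenvectors of the normalised Laplacian: each \<open>f a\<close> is
  the coefficient vector of a linear functional, and the functionals diagonalise the degree form
  and the Laplacian form simultaneously. The coordinates follow the increasing order of the
  eigenvalues.
\<close>
definition normal_coordinates :: "('v, 'e) wgraph \<Rightarrow> (nat \<Rightarrow> 'v \<Rightarrow> real) \<Rightarrow> bool" where
  "normal_coordinates G f \<longleftrightarrow>
    (\<forall>x. degree_form G x = (\<Sum>a<card (verts G). (\<Sum>v\<in>verts G. f a v * x v)\<^sup>2)) \<and>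
    (\<forall>x. laplacian_form G x =
      (\<Sum>a<card (verts G). nl_eigenvalues G ! a * (\<Sum>v\<in>verts G. f a v * x v)\<^sup>2))"

text \<open>
  With \<open>P\<close> orthogonal and \<open>D\<^sup>-\<^sup>1\<^sup>/\<^sup>2 L D\<^sup>-\<^sup>1\<^sup>/\<^sup>2 = P diag(es) P\<^sup>T\<close>, the rows of \<open>P\<^sup>T D\<^sup>1\<^sup>/\<^sup>2\<close> give the
  functionals. The matrix \<open>D\<^sup>-\<^sup>1 L\<close> is similar to this symmetric matrix, so its characteristic polynomial
  has the roots \<open>es\<close>; a permutation sorts them.
\<close>
lemma (in edge_weighted_multigraph) nl_eigenvalues_normal_coordinates:
  assumes ni: "isolated_verts G = {}"
  shows "length (nl_eigenvalues G) = card (verts G) \<and> (\<exists>f. normal_coordinates G f)"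
proof -
  define n where "n = card (verts G)"
  define vs where "vs = vertex_enum G"
  have vs: "set vs = verts G" "distinct vs"
    using someI_ex[OF finite_distinct_list[OF finite_verts]] unfolding vs_def vertex_enum_def by auto
  have lvs: "length vs = n" using distinct_card[OF vs(2)] vs(1) n_def by simp
  have bij: "bij_betw ((!) vs) {..<n} (verts G)" using bij_betw_nth[OF vs(2)] lvs vs(1) by blast
  have reindex: "(\<Sum>v\<in>verts G. h v) = (\<Sum>i<n. h (vs ! i))" for h :: "'v \<Rightarrow> real"
    by (rule sum.reindex_bij_betw[OF bij, symmetric])
  define d where "d i = degree_of G (vs ! i)" for i
  define r where "r i = sqrt (d i)" for i
  have d: "d i > 0" if "i < n" for i
    using degree_of_pos[OF ni] nth_mem[of i vs] that vs(1) lvs unfolding d_def by simp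
  have r: "r i > 0" "r i * r i = d i" if "i < n" for i
    using d[OF that] unfolding r_def by auto
  define w where "w i j = total_weight G (vs ! i) (vs ! j)" for i j
  have w_sym: "w i j = w j i" for i j
    unfolding w_def by (rule total_weight_commute)
  define A where "A = mat n n (\<lambda>(i,j). (if i = j then 1 else 0) - w i j / (r i * r j))"
  have A: "A \<in> carrier_mat n n" unfolding A_def by simp
  have symA: "transpose_mat A = A" unfolding A_def
    by (intro eq_matI) (auto simp: w_sym mult.commute)
  obtain P es where P: "P \<in> carrier_mat n n" "length es = n" "transpose_mat P * P = 1\<^sub>m n"
    "A = P * mat_diag n (\<lambda>i. es ! i) * transpose_mat P"
    by (rule real_spectral_theorem[OF A symA])
  have PPT: "P * transpose_mat P = 1\<^sub>m n"
    using mat_mult_left_right_inverse[OF _ P(1,3)] P(1) by simp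

  let ?R = "mat_diag n r" and ?R' = "mat_diag n (\<lambda>i. inverse (r i))"
  have RR: "?R' * ?R = 1\<^sub>m n" "?R * ?R' = 1\<^sub>m n"
    unfolding mat_diag_diag using r(1) by (auto intro!: eq_matI simp: mat_diag_def less_imp_neq[THEN not_sym])
  have N: "normalised_laplacian G = ?R' * A * ?R"
  proof -
    have L: "laplacian G = mat n n (\<lambda>(i,j). (if i = j then d j else 0) - w i j)"
      unfolding laplacian_def degree_mat_def adjacency_mat_def mat_diag_def n_def[symmetric] vs_def[symmetric]
      by (intro eq_matI) (auto simp: d_def w_def)
    have "normalised_laplacian G = mat n n (\<lambda>(i,j). inverse (d i) * ((if i = j then d j else 0) - w i j))"
      unfolding normalised_laplacian_def L n_def[symmetric] vs_def[symmetric] d_def[symmetric]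
      by (subst mat_diag_mult_left[of _ n n]) (auto intro!: eq_matI)
    also have "\<dots> = mat n n (\<lambda>(i,j). inverse (r i) * A $$ (i,j) * r j)"
    proof (rule eq_matI)
      fix i j assume "i < dim_row (mat n n (\<lambda>(i,j). inverse (r i) * A $$ (i,j) * r j))"
        "j < dim_col (mat n n (\<lambda>(i,j). inverse (r i) * A $$ (i,j) * r j))"
      then have ij: "i < n" "j < n" by auto
      have "inverse (d i) * ((if i = j then d j else 0) - w i j)
        = inverse (r i) * ((if i = j then 1 else 0) - w i j / (r i * r j)) * r j"
        using r(1)[OF ij(1)] r(1)[OF ij(2)] unfolding r(2)[OF ij(1), symmetric] r(2)[OF ij(2), symmetric]
        by (cases "i = j") (auto simp: field_simps)
      then show "mat n n (\<lambda>(i,j). inverse (d i) * ((if i = j then d j else 0) - w i j)) $$ (i,j)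
        = mat n n (\<lambda>(i,j). inverse (r i) * A $$ (i,j) * r j) $$ (i,j)"
        using ij unfolding A_def by simp
    qed simp_all
    also have "\<dots> = ?R' * A * ?R"
      unfolding mat_diag_mult_left[OF A]
      by (subst mat_diag_mult_right[of _ n n]) (auto intro!: eq_matI)
    finally show ?thesis .
  qed
  have carr: "normalised_laplacian G \<in> carrier_mat n n" "?R \<in> carrier_mat n n" "?R' \<in> carrier_mat n n"
    "mat_diag n (\<lambda>i. es ! i) \<in> carrier_mat n n" "transpose_mat P \<in> carrier_mat n n"
    using P(1) unfolding N by (simp_all add: mult_carrier_mat[OF mult_carrier_mat[OF mat_diag_dim A] mat_diag_dim])
  have simNA: "similar_mat (normalised_laplacian G) A"
    by (rule similar_matI[OF _ RR N]) (simp add: A carr)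
  have simAD: "similar_mat A (mat_diag n (\<lambda>i. es ! i))"
    by (rule similar_matI[OF _ PPT P(3,4)]) (simp add: A P(1) carr)
  have "char_poly (normalised_laplacian G) = char_poly (mat_diag n (\<lambda>i. es ! i))"
    using char_poly_similar[OF simNA] char_poly_similar[OF simAD] by simp
  also have "\<dots> = (\<Prod>a\<leftarrow>diag_mat (mat_diag n (\<lambda>i. es ! i)). [:- a, 1:])"
    by (rule char_poly_upper_triangular[of _ n]) (auto simp: mat_diag_def)
  also have "diag_mat (mat_diag n (\<lambda>i. es ! i)) = es"
    using P(2) by (intro nth_equalityI) (auto simp: diag_mat_def mat_diag_def)
  finally have cp: "char_poly (normalised_laplacian G) = (\<Prod>a\<leftarrow>es. [:- a, 1:])" .
  have "proots (\<Prod>a\<leftarrow>es. [:- a, 1:]) = mset es"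
  proof (induction es)
    case (Cons a es)
    have "(\<Prod>a\<leftarrow>es. [:- a, 1:]) \<noteq> 0" by (auto simp: prod_list_zero_iff)
    then show ?case using Cons by (simp add: proots_mult del: mult_pCons_left)
  qed simp
  then have nl: "nl_eigenvalues G = sort es"
    unfolding nl_eigenvalues_def cp by simp
  have "mset (nl_eigenvalues G) = mset es" unfolding nl by simp
  then obtain p where p: "p permutes {..<length es}" "permute_list p es = nl_eigenvalues G"
    by (rule mset_eq_permutation)
  have nth: "nl_eigenvalues G ! a = es ! p a" if "a < n" for a
    using permute_list_nth[OF p(1), of a] that P(2) p(2) by simp
  have bijp: "bij_betw p {..<n} {..<n}" using permutes_imp_bij[OF p(1)] P(2) by simp

  define idx where "idx = inv_into {..<n} ((!) vs)"
  have idx: "idx (vs ! i) = i" if "i < n" for i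
    unfolding idx_def using bij_betw_inv_into_left[OF bij, of i] that by simp
  define f where "f a v = P $$ (idx v, p a) * sqrt (degree_of G v)" for a v
  have f: "(\<Sum>v\<in>verts G. f a v * x v) = (\<Sum>i<n. P $$ (i, p a) * (r i * x (vs ! i)))" for a x
    unfolding reindex f_def by (intro sum.cong refl) (simp add: idx r_def d_def)
  have D: "degree_form G x = (\<Sum>a<n. (\<Sum>v\<in>verts G. f a v * x v)\<^sup>2)" for x
  proof -
    have "degree_form G x = (\<Sum>i<n. (r i * x (vs ! i))\<^sup>2)"
      unfolding degree_form_def reindex
      by (intro sum.cong refl) (simp add: r(2)[symmetric] d_def[symmetric] power2_eq_square)
    also have "\<dots> = (\<Sum>i<n. \<Sum>j<n. (1\<^sub>m n :: real mat) $$ (i,j) * (r i * x (vs ! i)) * (r j * x (vs ! j)))"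
      by (intro sum.cong refl) (simp add: power2_eq_square if_distrib[of "\<lambda>t. t * _"] cong: if_cong)
    also have "\<dots> = (\<Sum>a<n. (\<Sum>i<n. P $$ (i,a) * (r i * x (vs ! i)))\<^sup>2)"
      using P(1) PPT by (subst quadratic_form_diagonalised[OF P(1), where g = "\<lambda>_. 1"]) simp_all
    also have "\<dots> = (\<Sum>a<n. (\<Sum>i<n. P $$ (i, p a) * (r i * x (vs ! i)))\<^sup>2)"
      by (rule sum.reindex_bij_betw[OF bijp, symmetric])
    finally show ?thesis unfolding f .
  qed
  have L: "laplacian_form G x = (\<Sum>a<n. nl_eigenvalues G ! a * (\<Sum>v\<in>verts G. f a v * x v)\<^sup>2)" for x
  proof -
    have "laplacian_form G x = (\<Sum>i<n. d i * (x (vs ! i))\<^sup>2) - (\<Sum>i<n. \<Sum>j<n. w i j * x (vs ! i) * x (vs ! j))"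
      unfolding laplacian_form_def degree_form_def reindex d_def w_def ..
    also have "\<dots> = (\<Sum>i<n. \<Sum>j<n. (if i = j then d i * (x (vs ! i))\<^sup>2 else 0) - w i j * x (vs ! i) * x (vs ! j))"
      by (simp add: sum_subtractf)
    also have "\<dots> = (\<Sum>i<n. \<Sum>j<n. A $$ (i,j) * (r i * x (vs ! i)) * (r j * x (vs ! j)))"
    proof (intro sum.cong refl)
      fix i j assume "i \<in> {..<n}" "j \<in> {..<n}"
      then have ij: "i < n" "j < n" by auto
      show "(if i = j then d i * (x (vs ! i))\<^sup>2 else 0) - w i j * x (vs ! i) * x (vs ! j)
        = A $$ (i,j) * (r i * x (vs ! i)) * (r j * x (vs ! j))"
        using ij r(1)[OF ij(1)] r(1)[OF ij(2)] r(2)[OF ij(1), symmetric]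
        by (cases "i = j") (auto simp: A_def field_simps power2_eq_square)
    qed
    also have "\<dots> = (\<Sum>a<n. es ! a * (\<Sum>i<n. P $$ (i,a) * (r i * x (vs ! i)))\<^sup>2)"
      by (rule quadratic_form_diagonalised[OF P(1,4)])
    also have "\<dots> = (\<Sum>a<n. es ! p a * (\<Sum>i<n. P $$ (i, p a) * (r i * x (vs ! i)))\<^sup>2)"
      by (rule sum.reindex_bij_betw[OF bijp, symmetric])
    also have "\<dots> = (\<Sum>a<n. nl_eigenvalues G ! a * (\<Sum>i<n. P $$ (i, p a) * (r i * x (vs ! i)))\<^sup>2)"
      by (intro sum.cong refl) (simp add: nth)
    finally show ?thesis unfolding f .
  qed
  have "length (nl_eigenvalues G) = n" unfolding nl using P(2) by simp
  moreover have "normal_coordinates G f"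
    unfolding normal_coordinates_def n_def[symmetric] using D L by blast
  ultimately show ?thesis unfolding n_def by blast
qed

lemma sorted_nl_eigenvalues: "sorted (nl_eigenvalues G)"
  unfolding nl_eigenvalues_def by simp

context edge_weighted_multigraph
begin

lemma rayleigh_lower:
  assumes ni: "isolated_verts G = {}" and f: "normal_coordinates G f"
    and x: "\<And>a. a < j \<Longrightarrow> (\<Sum>v\<in>verts G. f a v * x v) = 0"
  shows "nl_eigenvalues G ! j * degree_form G x \<le> laplacian_form G x"
proof -
  let ?e = "(!) (nl_eigenvalues G)"
  have "?e j * (\<Sum>v\<in>verts G. f a v * x v)\<^sup>2 \<le> ?e a * (\<Sum>v\<in>verts G. f a v * x v)\<^sup>2"
    if "a < card (verts G)" for a
    using that x[of a] sorted_nth_mono[OF sorted_nl_eigenvalues, of j a G]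
      nl_eigenvalues_normal_coordinates[OF ni]
    by (cases "a < j") (auto intro!: mult_right_mono)
  then show ?thesis
    using f unfolding normal_coordinates_def by (auto simp: sum_distrib_left intro!: sum_mono)
qed

lemma rayleigh_upper:
  assumes ni: "isolated_verts G = {}" and f: "normal_coordinates G f" and j: "j < card (verts G)"
    and x: "\<And>a. j < a \<Longrightarrow> a < card (verts G) \<Longrightarrow> (\<Sum>v\<in>verts G. f a v * x v) = 0"
  shows "laplacian_form G x \<le> nl_eigenvalues G ! j * degree_form G x"
proof -
  let ?e = "(!) (nl_eigenvalues G)"
  have "?e a * (\<Sum>v\<in>verts G. f a v * x v)\<^sup>2 \<le> ?e j * (\<Sum>v\<in>verts G. f a v * x v)\<^sup>2"
    if "a < card (verts G)" for a
    using that x[of a] sorted_nth_mono[OF sorted_nl_eigenvalues, of a j G]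
      nl_eigenvalues_normal_coordinates[OF ni] j
    by (cases "j < a") (auto intro!: mult_right_mono)
  then show ?thesis
    using f unfolding normal_coordinates_def by (auto simp: sum_distrib_left intro!: sum_mono)
qed

end

section \<open>Homogeneous linear systems\<close>

text \<open>
  Padding the coefficient matrix with zero rows, of which there is at least one, makes it square and
  singular.
\<close>
lemma homogeneous_system_nontrivial_solution:
  fixes V :: "'v set" and F :: "('v \<Rightarrow> real) set"
  assumes V: "finite V" and F: "finite F" and less: "card F < card V"
  obtains x where "\<exists>v\<in>V. x v \<noteq> 0" "\<And>f. f \<in> F \<Longrightarrow> (\<Sum>v\<in>V. f v * x v) = 0"
proof -
  define n where "n = card V"
  obtain vs where vs: "set vs = V" "distinct vs" using finite_distinct_list[OF V] by blast
  obtain fs where fs: "set fs = F" "distinct fs" using finite_distinct_list[OF F] by blast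
  have lvs: "length vs = n" using vs distinct_card n_def by metis
  have lfs: "length fs < n" using fs distinct_card[OF fs(2)] less n_def by simp
  have bij: "bij_betw ((!) vs) {..<n} V" using bij_betw_nth[OF vs(2)] lvs vs(1) by blast
  define M where "M = mat n n (\<lambda>(i,j). if i < length fs then (fs ! i) (vs ! j) else 0)"
  have M: "M \<in> carrier_mat n n" by (simp add: M_def)
  let ?e = "unit_vec n (n - 1) :: real vec"
  have "transpose_mat M *\<^sub>v ?e = 0\<^sub>v n"
    using lfs unfolding M_def by (intro eq_vecI) auto
  moreover have "?e \<noteq> 0\<^sub>v n"
  proof
    assume "?e = 0\<^sub>v n"
    from arg_cong[OF this, of "\<lambda>w. w $ (n - 1)"] show False using lfs by simp
  qed
  ultimately have "det (transpose_mat M) = 0"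
    using M by (subst det_0_iff_vec_prod_zero[of _ n]) (auto intro!: exI[of _ ?e])
  then have "det M = 0" using det_transpose[OF M] by simp
  then obtain z where z: "z \<in> carrier_vec n" "z \<noteq> 0\<^sub>v n" "M *\<^sub>v z = 0\<^sub>v n"
    using det_0_iff_vec_prod_zero[OF M] by blast
  define x where "x v = z $ (inv_into {..<n} ((!) vs) v)" for v
  have x: "x (vs ! i) = z $ i" if "i < n" for i
    unfolding x_def using bij_betw_inv_into_left[OF bij, of i] that by simp
  have "\<exists>i<n. z $ i \<noteq> 0"
  proof (rule ccontr)
    assume "\<not> ?thesis"
    then have "z = 0\<^sub>v n" using z(1) by (intro eq_vecI) auto
    with z(2) show False by simp
  qed
  then have nz: "\<exists>v\<in>V. x v \<noteq> 0" using x vs(1) lvs nth_mem by metis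
  have "(\<Sum>v\<in>V. f v * x v) = 0" if "f \<in> F" for f
  proof -
    obtain i where i: "i < length fs" "f = fs ! i" using \<open>f \<in> F\<close> fs(1) in_set_conv_nth by metis
    have "(\<Sum>v\<in>V. f v * x v) = (\<Sum>j<n. f (vs ! j) * x (vs ! j))"
      by (rule sum.reindex_bij_betw[OF bij, symmetric])
    also have "\<dots> = (M *\<^sub>v z) $ i"
      using i lfs z(1) x unfolding M_def
      by (simp add: scalar_prod_def lessThan_atLeast0)
    also have "\<dots> = 0" using z(3) i lfs by simp
    finally show ?thesis .
  qed
  with nz show ?thesis by (rule that)
qed

text \<open>
  This replaces the intersection of subspaces in the Courant-Fischer argument: each system of
  functionals cuts out a subspace, and fewer than \<open>card V\<close> equations in total leave a common nonzero
  vector. The functionals \<open>g b\<close> see only the coordinates in \<open>W\<close>, the vertex set of the subgraph.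
\<close>
lemma test_vector:
  fixes V :: "'v set" and f g :: "nat \<Rightarrow> 'v \<Rightarrow> real"
  assumes V: "finite V" and W: "W \<subseteq> V"
    and fin: "finite F" "finite A" "finite B"
    and less: "card F + card A + card B < card V"
  obtains x where "\<exists>v\<in>V. x v \<noteq> 0"
    "\<And>h. h \<in> F \<Longrightarrow> (\<Sum>v\<in>V. h v * x v) = 0"
    "\<And>a. a \<in> A \<Longrightarrow> (\<Sum>v\<in>V. f a v * x v) = 0"
    "\<And>b. b \<in> B \<Longrightarrow> (\<Sum>v\<in>W. g b v * x v) = 0"
proof -
  define g' where "g' b v = (if v \<in> W then g b v else 0)" for b v
  let ?F = "F \<union> f ` A \<union> g' ` B"
  have "card ?F \<le> card F + card (f ` A) + card (g' ` B)"
    using card_Un_le[of "F \<union> f ` A" "g' ` B"] card_Un_le[of F "f ` A"] by linarith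
  also have "\<dots> \<le> card F + card A + card B"
    using card_image_le[OF fin(2), of f] card_image_le[OF fin(3), of g'] by linarith
  finally have "card ?F < card V" using less by linarith
  then obtain x where x: "\<exists>v\<in>V. x v \<noteq> 0" "\<And>h. h \<in> ?F \<Longrightarrow> (\<Sum>v\<in>V. h v * x v) = 0"
    using homogeneous_system_nontrivial_solution[OF V, of ?F] fin by blast
  have "(\<Sum>v\<in>V. g' b v * x v) = (\<Sum>v\<in>W. g b v * x v)" for b
    unfolding g'_def using V W by (intro sum.mono_neutral_cong_right) auto
  then show ?thesis using x by (intro that[of x]) force+
qed

text \<open>
  At an eigenvector all normal coordinates but one vanish, so the eigenvalue is the quotient of the
  Laplacian form by the degree form. The bounds express that the Laplacian form and the signless
  Laplacian form are sums of squares with positive weights.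
\<close>
lemma (in edge_weighted_multigraph) nl_eigenvalues_bounds:
  assumes ni: "isolated_verts G = {}" and a: "a < card (verts G)"
  shows "0 \<le> nl_eigenvalues G ! a" "nl_eigenvalues G ! a \<le> 2"
proof -
  let ?n = "card (verts G)"
  obtain f where f: "normal_coordinates G f"
    using nl_eigenvalues_normal_coordinates[OF ni] by blast
  obtain x where x: "\<exists>v\<in>verts G. x v \<noteq> 0"
    "\<And>b. b \<in> {..<?n} - {a} \<Longrightarrow> (\<Sum>v\<in>verts G. f b v * x v) = 0"
    using test_vector[OF finite_verts subset_refl, of "{}" "{..<?n} - {a}" "{}" f f] a by auto
  have "laplacian_form G x = nl_eigenvalues G ! a * degree_form G x"
    using rayleigh_lower[OF ni f, of a x] rayleigh_upper[OF ni f a, of x] x(2) a by force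
  moreover have pos: "degree_form G x > 0" by (rule degree_form_pos[OF ni x(1)])
  moreover obtain p q where pq: "\<forall>e\<in>edges G. ends G e = Upair (p e) (q e)"
    by (rule obtain_endpoints)
  have "0 \<le> laplacian_form G x" "0 \<le> 2 * degree_form G x - laplacian_form G x"
    unfolding signless_form_edges[OF pq] unfolding laplacian_form_edges[OF pq]
    by (simp_all add: sum_nonneg less_imp_le weight_pos)
  ultimately have "0 \<le> nl_eigenvalues G ! a * degree_form G x"
    "0 \<le> (2 - nl_eigenvalues G ! a) * degree_form G x"
    by (simp_all add: left_diff_distrib)
  with pos show "0 \<le> nl_eigenvalues G ! a" "nl_eigenvalues G ! a \<le> 2"
    by (simp_all add: zero_le_mult_iff)
qed

section \<open>Vectors constrained along the edges of a subgraph\<close>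

lemma sym_rtrancl_adjacency: "sym ((adjacency H)\<^sup>*)"
proof (rule sym_rtrancl, rule symI)
  fix u v assume "(u, v) \<in> adjacency H"
  moreover have "Upair u v = Upair v u" by simp
  ultimately show "(v, u) \<in> adjacency H" unfolding adjacency_def by simp
qed

text \<open>
  The functionals in \<open>F\<close> form a homogeneous linear system on \<open>V\<close>. The factor \<open>\<tau> = 1\<close> asks for equal values at
  the two ends of each edge, and \<open>\<tau> = - 1\<close> for opposite values.
\<close>
definition constrains_edges :: "('v, 'e) wgraph \<Rightarrow> 'v set \<Rightarrow> real \<Rightarrow> ('v \<Rightarrow> real) set \<Rightarrow> bool" where
  "constrains_edges H V \<tau> F \<longleftrightarrow> finite F \<and> (\<forall>x. (\<forall>f\<in>F. (\<Sum>v\<in>V. f v * x v) = 0) \<longrightarrow>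
    (\<forall>e\<in>edges H. \<forall>u v. ends H e = Upair u v \<longrightarrow> x u = \<tau> * x v))"

text \<open>
  On a component \<open>C \<in> K\<close> a solution is determined by its value at one representative, through the signs
  \<open>\<sigma>\<close>; this takes one equation for each other vertex of \<open>C\<close>. On the remaining components every vertex
  receives the equation that its value is zero. So each component in \<open>K\<close> saves exactly one equation.
\<close>
lemma component_constraints:
  fixes H :: "('v, 'e) wgraph" and \<sigma> :: "'v \<Rightarrow> real"
  assumes V: "finite V" and HV: "verts H \<subseteq> V"
    and ends: "\<And>e. e \<in> edges H \<Longrightarrow> set_uprod (ends H e) \<subseteq> verts H"
    and K: "K \<subseteq> components H"
    and \<sigma>: "\<And>v. \<sigma> v * \<sigma> v = 1"
    and \<tau>: "\<And>C e u v. \<lbrakk>C \<in> K; e \<in> edges H; ends H e = Upair u v; u \<in> C; v \<in> C\<rbrakk> \<Longrightarrow> \<sigma> u = \<tau> * \<sigma> v"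
  shows "\<exists>F. constrains_edges H V \<tau> F \<and> card F + card K \<le> card (verts H)"
proof -
  let ?A = "(adjacency H)\<^sup>*"
  define cls where "cls v = ?A `` {v}" for v
  note symA = sym_rtrancl_adjacency[of H]
  have fH: "finite (verts H)" using V HV finite_subset by blast
  have cls_eq: "cls u = cls v" if "(u, v) \<in> ?A" for u v
    using that symD[OF symA that] unfolding cls_def by (auto intro: rtrancl_trans)
  have comp_cls: "C = cls v" if "C \<in> components H" "v \<in> C" for C v
  proof -
    from that(1) obtain w where w: "w \<in> verts H" "C = cls w"
      unfolding components_def quotient_def cls_def by blast
    then have "(w, v) \<in> ?A" using that(2) unfolding cls_def by simp
    then show ?thesis using cls_eq w(2) by blast
  qed
  have cls_self: "v \<in> cls v" for v unfolding cls_def by simp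
  have step: "v \<in> verts H" if "(u, v) \<in> adjacency H" for u v
    using that ends unfolding adjacency_def by fastforce
  have cls_verts: "cls w \<subseteq> verts H" if "w \<in> verts H" for w
  proof
    fix v assume "v \<in> cls w"
    then have "(w, v) \<in> ?A" unfolding cls_def by simp
    then show "v \<in> verts H" using that by (cases rule: rtranclE) (auto intro: step)
  qed
  define rep where "rep C = (SOME v. v \<in> C)" for C :: "'v set"
  have rep: "rep C \<in> C" "rep C \<in> verts H" "cls (rep C) = C" if "C \<in> K" for C
  proof -
    have c: "C \<in> components H" using that K by blast
    then obtain w where w: "w \<in> verts H" "C = cls w"
      unfolding components_def quotient_def cls_def by blast
    then show 1: "rep C \<in> C" unfolding rep_def using cls_self by (metis someI)
    then show "rep C \<in> verts H" using cls_verts w by blast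
    show "cls (rep C) = C" using comp_cls[OF c 1] by simp
  qed
  have inj: "inj_on rep K" by (rule inj_onI) (metis rep(3))
  define I where "I = verts H - rep ` K"
  have card_I: "card I + card K = card (verts H)"
  proof -
    have "rep ` K \<subseteq> verts H" using rep(2) by blast
    then show ?thesis unfolding I_def
      using card_image[OF inj] fH card_mono[OF fH, of "rep ` K"]
      by (simp add: card_Diff_subset finite_subset)
  qed
  \<comment> \<open>The equation for \<open>i\<close> reads \<open>x i = c i * x r\<close> with \<open>r\<close> the representative of its class; outside the
    classes in \<open>K\<close> the coefficient 0 makes it say \<open>x i = 0\<close>.\<close>
  define c where "c v = (if cls v \<in> K then \<sigma> v * \<sigma> (rep (cls v)) else 0)" for v
  define g where "g i = (\<lambda>v. of_bool (v = i) - c i * of_bool (v = rep (cls i)))" for i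
  have g: "(\<Sum>v\<in>V. g i v * x v) = x i - c i * x (rep (cls i))" if i: "i \<in> verts H" for i and x :: "'v \<Rightarrow> real"
  proof -
    have "(\<Sum>v\<in>V. g i v * x v) = (\<Sum>v\<in>V. if v = i then x v else 0) - (\<Sum>v\<in>V. if v = rep (cls i) then c i * x v else 0)"
      unfolding sum_subtractf[symmetric] g_def by (intro sum.cong refl) (auto simp: algebra_simps)
    also have "(\<Sum>v\<in>V. if v = i then x v else 0) = x i" using i HV V by auto
    also have "(\<Sum>v\<in>V. if v = rep (cls i) then c i * x v else 0) = c i * x (rep (cls i))"
    proof (cases "cls i \<in> K")
      case True
      then have "rep (cls i) \<in> V" using rep(2) HV by blast
      then show ?thesis using V by simp
    next
      case False
      then show ?thesis unfolding c_def by simp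
    qed
    finally show ?thesis .
  qed
  show ?thesis
  proof (intro exI[of _ "g ` I"] conjI)
    show "card (g ` I) + card K \<le> card (verts H)"
      using card_I card_image_le[of I g] fH unfolding I_def by fastforce
    show "constrains_edges H V \<tau> (g ` I)"
      unfolding constrains_edges_def
    proof (intro conjI allI impI ballI)
      show "finite (g ` I)" unfolding I_def using fH by simp
      fix x :: "'v \<Rightarrow> real" and e u v
      assume x: "\<forall>f\<in>g ` I. (\<Sum>v\<in>V. f v * x v) = 0"
        and e: "e \<in> edges H" "ends H e = Upair u v"
      have val: "x i = c i * x (rep (cls i))" if i: "i \<in> verts H" for i
      proof (cases "i \<in> rep ` K")
        case True
        then obtain C where C: "C \<in> K" "i = rep C" by blast
        then have "cls i = C" using rep(3) by simp
        then show ?thesis using C \<sigma> unfolding c_def by simp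
      next
        case False
        then show ?thesis using x g[OF i, of x] i unfolding I_def by simp
      qed
      have uv: "u \<in> verts H" "v \<in> verts H" using ends[OF e(1)] e(2) by auto
      have "(u, v) \<in> adjacency H" using e unfolding adjacency_def by blast
      then have cuv: "cls u = cls v" by (intro cls_eq) blast
      have "c u = \<tau> * c v"
      proof (cases "cls v \<in> K")
        case True
        have "\<sigma> u = \<tau> * \<sigma> v" by (rule \<tau>[OF True e]) (use cuv cls_self in blast)+
        then show ?thesis unfolding c_def cuv by simp
      qed (simp add: c_def cuv)
      then show "x u = \<tau> * x v" using val[OF uv(1)] val[OF uv(2)] cuv by (metis mult.assoc)
    qed
  qed
qed

lemma connected_constraints:
  assumes "finite V" "verts H \<subseteq> V" "\<And>e. e \<in> edges H \<Longrightarrow> set_uprod (ends H e) \<subseteq> verts H"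
  shows "\<exists>F. constrains_edges H V 1 F \<and> card F + card (components H) \<le> card (verts H)"
  by (rule component_constraints[OF assms subset_refl, of "\<lambda>_. 1"]) simp_all

text \<open>
  The sign \<open>\<sigma>\<close> is the indicator of the two sides of a bipartition.
\<close>
lemma bipartite_constraints:
  fixes H :: "('v, 'e) wgraph"
  assumes V: "finite V" and HV: "verts H \<subseteq> V"
    and ends: "\<And>e. e \<in> edges H \<Longrightarrow> set_uprod (ends H e) \<subseteq> verts H"
  shows "\<exists>F. constrains_edges H V (- 1) F \<and> card F + card (bipartite_components H) \<le> card (verts H)"
proof -
  let ?K = "bipartite_components H"
  have K: "?K \<subseteq> components H" unfolding bipartite_components_def by blast
  have "\<forall>C\<in>?K. \<exists>X. \<forall>e\<in>edges H. set_uprod (ends H e) \<subseteq> C \<longrightarrow>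
      (\<exists>a\<in>X. \<exists>b\<in>-X. ends H e = Upair a b)"
  proof
    fix C assume "C \<in> ?K"
    then obtain X Y where XY: "X \<inter> Y = {}"
      "\<forall>e\<in>edges (induced_subgraph H C). \<exists>x\<in>X. \<exists>y\<in>Y. ends (induced_subgraph H C) e = Upair x y"
      unfolding bipartite_components_def bipartite_def by blast
    then show "\<exists>X. \<forall>e\<in>edges H. set_uprod (ends H e) \<subseteq> C \<longrightarrow> (\<exists>a\<in>X. \<exists>b\<in>-X. ends H e = Upair a b)"
      unfolding induced_subgraph_def by (intro exI[of _ X]) fastforce
  qed
  then obtain X where X: "\<And>C e. C \<in> ?K \<Longrightarrow> e \<in> edges H \<Longrightarrow> set_uprod (ends H e) \<subseteq> C \<Longrightarrow>
      \<exists>a\<in>X C. \<exists>b\<in>- X C. ends H e = Upair a b"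
    by metis
  define \<sigma> :: "'v \<Rightarrow> real" where "\<sigma> v = (if v \<in> X ((adjacency H)\<^sup>* `` {v}) then 1 else -1)" for v
  have cls: "C = (adjacency H)\<^sup>* `` {v}" if "C \<in> components H" "v \<in> C" for C v
  proof -
    from that sym_rtrancl_adjacency[of H] show ?thesis unfolding components_def quotient_def
      by (auto intro: rtrancl_trans dest: symD)
  qed
  have "\<sigma> u = - 1 * \<sigma> v" if h: "C \<in> ?K" "e \<in> edges H" "ends H e = Upair u v" "u \<in> C" "v \<in> C" for C e u v
  proof -
    have "set_uprod (ends H e) \<subseteq> C" using h by simp
    from X[OF h(1,2) this] have "u \<in> X C \<longleftrightarrow> v \<notin> X C" unfolding h(3) by (auto simp: Upair_inject)
    then show ?thesis unfolding \<sigma>_def using cls[of C u] cls[of C v] h K by auto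
  qed
  note \<sigma>_edge = this
  have \<sigma>_sq: "\<sigma> v * \<sigma> v = 1" for v unfolding \<sigma>_def by simp
  show ?thesis by (rule component_constraints[OF V HV ends K \<sigma>_sq \<sigma>_edge])
qed

section \<open>Interlacing under edge deletion\<close>

text \<open>
  The situation of \<open>H = G - R - S\<close>: removing the isolated vertices of \<open>G - R\<close> removes no further edges,
  so \<open>H\<close> has exactly the edges of \<open>G\<close> outside \<open>R\<close>.
\<close>
locale edge_deleted_pair =
  G: edge_weighted_multigraph G + H: edge_weighted_multigraph H
  for G H :: "('v, 'e) wgraph" +
  fixes R :: "'e set"
  assumes verts_subset: "verts H \<subseteq> verts G"
    and edges_diff: "edges H = edges G - R"
    and ends_eq: "ends H = ends G"
    and weight_eq: "weight H = weight G"
    and no_isolated: "isolated_verts G = {}" "isolated_verts H = {}"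
begin

lemma degree_form_le: "degree_form H x \<le> degree_form G x"
proof -
  obtain p q where pq: "\<forall>e\<in>edges G. ends G e = Upair (p e) (q e)"
    by (rule G.obtain_endpoints)
  then have pqH: "\<forall>e\<in>edges H. ends H e = Upair (p e) (q e)" unfolding edges_diff ends_eq by blast
  show ?thesis
    unfolding G.degree_form_edges[OF pq] H.degree_form_edges[OF pqH] edges_diff weight_eq
    by (rule sum_mono2) (auto simp: G.finite_edges less_imp_le G.weight_pos)
qed

lemma laplacian_form_eq:
  assumes "\<And>e u v. \<lbrakk>e \<in> edges G; e \<in> R; ends G e = Upair u v\<rbrakk> \<Longrightarrow> x u = x v"
  shows "laplacian_form H x = laplacian_form G x"
proof -
  obtain p q where pq: "\<forall>e\<in>edges G. ends G e = Upair (p e) (q e)"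
    by (rule G.obtain_endpoints)
  then have pqH: "\<forall>e\<in>edges H. ends H e = Upair (p e) (q e)" unfolding edges_diff ends_eq by blast
  have R: "x (p e) = x (q e)" if "e \<in> edges G" "e \<in> R" for e
    using assms that pq by blast
  show ?thesis
    unfolding G.laplacian_form_edges[OF pq] H.laplacian_form_edges[OF pqH] edges_diff weight_eq
    by (rule sum.mono_neutral_left) (auto simp: G.finite_edges R)
qed

lemma signless_form_eq:
  assumes "\<And>e u v. \<lbrakk>e \<in> edges G; e \<in> R; ends G e = Upair u v\<rbrakk> \<Longrightarrow> x u = - x v"
  shows "2 * degree_form H x - laplacian_form H x = 2 * degree_form G x - laplacian_form G x"
proof -
  obtain p q where pq: "\<forall>e\<in>edges G. ends G e = Upair (p e) (q e)"
    by (rule G.obtain_endpoints)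
  then have pqH: "\<forall>e\<in>edges H. ends H e = Upair (p e) (q e)" unfolding edges_diff ends_eq by blast
  have R: "x (p e) = - x (q e)" if "e \<in> edges G" "e \<in> R" for e
    using assms that pq by blast
  show ?thesis
    unfolding G.signless_form_edges[OF pq] H.signless_form_edges[OF pqH] edges_diff weight_eq
    by (rule sum.mono_neutral_left) (auto simp: G.finite_edges R)
qed

text \<open>
  The test vector satisfies the system \<open>F\<close>, its first \<open>j\<close> normal coordinates in \<open>G\<close> vanish, and so do its
  normal coordinates in \<open>H\<close> beyond the \<open>i\<close>-th. Its Laplacian forms in \<open>G\<close> and \<open>H\<close> agree and lie between
  the two eigenvalues times the degree forms.
\<close>
lemma eigenvalue_lower:
  assumes F: "constrains_edges (edge_subgraph G R) (verts G) 1 F"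
    and i: "i < card (verts H)"
    and count: "card F + j + (card (verts H) - Suc i) < card (verts G)"
  shows "nl_eigenvalues G ! j \<le> nl_eigenvalues H ! i"
proof -
  let ?m = "card (verts H)"
  let ?lam = "(!) (nl_eigenvalues G)" and ?mu = "(!) (nl_eigenvalues H)"
  obtain f where f: "normal_coordinates G f"
    using G.nl_eigenvalues_normal_coordinates[OF no_isolated(1)] by blast
  obtain g where g: "normal_coordinates H g"
    using H.nl_eigenvalues_normal_coordinates[OF no_isolated(2)] by blast
  have finF: "finite F" using F unfolding constrains_edges_def by blast
  obtain x where x: "\<exists>v\<in>verts G. x v \<noteq> 0"
    "\<And>h. h \<in> F \<Longrightarrow> (\<Sum>v\<in>verts G. h v * x v) = 0"
    "\<And>a. a \<in> {..<j} \<Longrightarrow> (\<Sum>v\<in>verts G. f a v * x v) = 0"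
    "\<And>b. b \<in> {Suc i..<?m} \<Longrightarrow> (\<Sum>v\<in>verts H. g b v * x v) = 0"
    using test_vector[OF G.finite_verts verts_subset finF, of "{..<j}" "{Suc i..<?m}" f g] count
    by auto
  have "?lam j * degree_form G x \<le> laplacian_form G x"
    using x(3) by (intro G.rayleigh_lower[OF no_isolated(1) f]) simp
  also have "\<dots> = laplacian_form H x"
    using F x(2) unfolding constrains_edges_def
    by (intro laplacian_form_eq[symmetric]) (simp add: edge_subgraph_def)
  also have "\<dots> \<le> ?mu i * degree_form H x"
    using x(4) by (intro H.rayleigh_upper[OF no_isolated(2) g i]) simp_all
  also have "\<dots> \<le> ?mu i * degree_form G x"
    using degree_form_le H.nl_eigenvalues_bounds(1)[OF no_isolated(2) i] by (rule mult_left_mono)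
  finally show ?thesis
    using G.degree_form_pos[OF no_isolated(1) x(1)] by simp
qed

text \<open>
  The same argument for the signless Laplacian, whose eigenvalues relative to \<open>D\<close> are \<open>2 - \<lambda>\<close> and \<open>2 - \<mu>\<close>:
  this reverses the order, and the bound \<open>\<mu> \<le> 2\<close> takes the place of \<open>0 \<le> \<mu>\<close>.
\<close>
lemma eigenvalue_upper:
  assumes F: "constrains_edges (edge_subgraph G R) (verts G) (- 1) F"
    and j: "j < card (verts G)" and i: "i < card (verts H)"
    and count: "card F + (card (verts G) - Suc j) + i < card (verts G)"
  shows "nl_eigenvalues H ! i \<le> nl_eigenvalues G ! j"
proof -
  let ?n = "card (verts G)"
  let ?lam = "(!) (nl_eigenvalues G)" and ?mu = "(!) (nl_eigenvalues H)"
  obtain f where f: "normal_coordinates G f"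
    using G.nl_eigenvalues_normal_coordinates[OF no_isolated(1)] by blast
  obtain g where g: "normal_coordinates H g"
    using H.nl_eigenvalues_normal_coordinates[OF no_isolated(2)] by blast
  have finF: "finite F" using F unfolding constrains_edges_def by blast
  obtain x where x: "\<exists>v\<in>verts G. x v \<noteq> 0"
    "\<And>h. h \<in> F \<Longrightarrow> (\<Sum>v\<in>verts G. h v * x v) = 0"
    "\<And>a. a \<in> {Suc j..<?n} \<Longrightarrow> (\<Sum>v\<in>verts G. f a v * x v) = 0"
    "\<And>b. b \<in> {..<i} \<Longrightarrow> (\<Sum>v\<in>verts H. g b v * x v) = 0"
    using test_vector[OF G.finite_verts verts_subset finF, of "{Suc j..<?n}" "{..<i}" f g] count
    by auto
  have "laplacian_form G x \<le> ?lam j * degree_form G x"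
    using x(3) by (intro G.rayleigh_upper[OF no_isolated(1) f j]) simp_all
  then have "(2 - ?lam j) * degree_form G x \<le> 2 * degree_form G x - laplacian_form G x"
    by (simp add: left_diff_distrib)
  also have "\<dots> = 2 * degree_form H x - laplacian_form H x"
    using F x(2) unfolding constrains_edges_def
    by (intro signless_form_eq[symmetric]) (simp add: edge_subgraph_def)
  also have "\<dots> \<le> (2 - ?mu i) * degree_form H x"
  proof -
    have "?mu i * degree_form H x \<le> laplacian_form H x"
      using x(4) by (intro H.rayleigh_lower[OF no_isolated(2) g]) simp
    then show ?thesis by (simp add: left_diff_distrib)
  qed
  also have "\<dots> \<le> (2 - ?mu i) * degree_form G x"
    using degree_form_le H.nl_eigenvalues_bounds(2)[OF no_isolated(2) i]
    by (intro mult_left_mono) simp_all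
  finally show ?thesis
    using G.degree_form_pos[OF no_isolated(1) x(1)] by simp
qed

end

lemma edge_deleted_pair_del_isolated:
  fixes G :: "('v, 'e) wgraph" and R :: "'e set"
  assumes "edge_weighted_multigraph G" and ni: "isolated_verts G = {}"
  defines "S \<equiv> isolated_verts (del_edges G R)"
  shows "edge_deleted_pair G (del_verts (del_edges G R) S) R"
proof -
  interpret G: edge_weighted_multigraph G by fact
  let ?G' = "del_edges G R"
  interpret G': edge_weighted_multigraph ?G'
    by unfold_locales
      (auto simp: del_edges_def G.finite_verts G.finite_edges G.weight_pos dest: G.ends_in_verts)
  have S: "S = {v \<in> verts G. \<forall>e\<in>edges G - R. v \<notin> set_uprod (ends G e)}"
    unfolding S_def G'.isolated_verts_no_edges by (simp add: del_edges_def)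
  let ?H = "del_verts ?G' S"
  have H: "verts ?H = verts G - S" "ends ?H = ends G" "weight ?H = weight G"
    unfolding del_verts_def del_edges_def by simp_all
  have EH: "edges ?H = edges G - R"
    unfolding del_verts_def del_edges_def S by auto
  interpret H: edge_weighted_multigraph ?H
  proof (unfold_locales, unfold H EH)
    show "set_uprod (ends G e) \<subseteq> verts G - S" if "e \<in> edges G - R" for e
      using G.ends_in_verts that unfolding S by blast
  qed (auto simp: G.finite_verts G.finite_edges G.weight_pos)
  have "isolated_verts ?H = {}"
    unfolding H.isolated_verts_no_edges H EH unfolding S by auto
  with ni show ?thesis by unfold_locales (auto simp: H EH)
qed

theorem corollary5p13:
  fixes G :: "('v, 'e) wgraph"
    and R :: "'e set" and S :: "'v set"
    and n k s c b i :: int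
    and lam mu :: "int \<Rightarrow> real"
  assumes "edge_weighted_multigraph G"
    and "n = int (card (verts G))"
    and "isolated_verts G = {}"
    and "R \<subseteq> edges G"
    and "S = isolated_verts (del_edges G R)"
    and "k = int (card S)"
    and "lam = nl_eigenvalue G"
    and "mu = nl_eigenvalue (del_verts (del_edges G R) S)"
    and "s = int (card (verts (edge_subgraph G R)))"
    and "c = int (card (components (edge_subgraph G R)))"
    and "b = int (card (bipartite_components (edge_subgraph G R)))"
    and "1 \<le> i" and "i \<le> n - k"
  shows "(1 \<le> i - s + c + k \<and> i - s + c + k \<le> n \<longrightarrow> lam (i - s + c + k) \<le> mu i) \<and>
    (1 \<le> i + s - b \<and> i + s - b \<le> n \<longrightarrow> mu i \<le> lam (i + s - b))"
proof -
  let ?H = "del_verts (del_edges G R) S" and ?Q = "edge_subgraph G R"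
  interpret edge_deleted_pair G ?H R
    using edge_deleted_pair_del_isolated[OF assms(1,3)] assms(5) by simp
  have "S \<subseteq> verts G" unfolding assms(5) isolated_verts_def del_edges_def by auto
  moreover have "verts ?H = verts G - S" unfolding del_verts_def del_edges_def by simp
  ultimately have m: "int (card (verts ?H)) = n - k"
    using G.finite_verts card_mono[OF G.finite_verts, of S] assms(2,6)
    by (simp add: card_Diff_subset finite_subset of_nat_diff)
  have Q: "verts ?Q \<subseteq> verts G" "\<And>e. e \<in> edges ?Q \<Longrightarrow> set_uprod (ends ?Q e) \<subseteq> verts ?Q"
    using G.ends_in_verts assms(4) by (auto simp: edge_subgraph_def)
  note idx = assms(2,12,13) m
  show ?thesis
  proof (intro conjI impI)
    assume j: "1 \<le> i - s + c + k \<and> i - s + c + k \<le> n"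
    \<comment> \<open>Positions are shifted by one because lists are indexed from 0. The equations number
      at most \<open>(s - c) + (i - s + c + k - 1) + (n - k - i) = n - 1\<close>.\<close>
    obtain F where F: "constrains_edges ?Q (verts G) 1 F" "card F + card (components ?Q) \<le> card (verts ?Q)"
      using connected_constraints[OF G.finite_verts Q] by blast
    show "lam (i - s + c + k) \<le> mu i"
      unfolding assms(7,8) nl_eigenvalue_def
      by (rule eigenvalue_lower[OF F(1)]) (use j idx F(2) assms(9,10) in linarith)+
  next
    assume j: "1 \<le> i + s - b \<and> i + s - b \<le> n"
    \<comment> \<open>Here the equations number at most \<open>(s - b) + (n - (i + s - b)) + (i - 1) = n - 1\<close>.\<close>
    obtain F where F: "constrains_edges ?Q (verts G) (- 1) F"
      "card F + card (bipartite_components ?Q) \<le> card (verts ?Q)"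
      using bipartite_constraints[OF G.finite_verts Q] by blast
    show "mu i \<le> lam (i + s - b)"
      unfolding assms(7,8) nl_eigenvalue_def
      by (rule eigenvalue_upper[OF F(1)]) (use j idx F(2) assms(9,11) in linarith)+
  qed
qed

end
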